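(* Let $X$ be a Banach space and let $T\in L(X)$ be such that the Moore-Penrose inverse $T^{\dagger}$ exists. Let $Y$ be a closed subspace of $X$ invariant under $T$ and $T^{\dagger}$. (i) If $Y\neq\{0\}$ and $T'$ (resp. $T^{\dagger\prime}$) denotes the operator induced by $T$ (resp. by $T^{\dagger}$) on $Y$ by restriction, then $T^{\dagger\prime}$ is the Moore-Penrose inverse of $T'$ in $L(Y)$. (ii) If $Y\neq X$ and $T_Y$ (resp. $T^{\dagger}_Y$) denotes the operator induced by $T$ (resp. by $T^{\dagger}$) on the quotient Banach space $X/Y$, then $T^{\dagger}_Y$ is the Moore-Penrose inverse of $T_Y$ in $L(X/Y)$. (iii) Let $X_1,X_2$ be Banach spaces and let $T_i\in L(X_i)$, $i=1,2$, be operators such that $T_i^{\dagger}\in L(X_i)$ exists for $i=1,2$. Let $X=X_1\oplus X_2$ be the Banach space with norm $\|x_1\oplus x_2\|=\max\{\|x_1\|,\|x_2\|\}$. Then $T_1^{\dagger}\oplus T_2^{\dagger}$ is the Moore-Penrose inverse of $T=T_1\oplus T_2$ in $L(X)$.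
   Context: Scalars are complex. For a Banach space $X$, $L(X)$ is the Banach algebra of bounded linear operators on $X$ with the operator norm. An operator $H\in L(X)$ is hermitian if $\|\exp(itH)\|=1$ for all $t\in\mathbb{R}$. The Moore-Penrose inverse of $T\in L(X)$, denoted $T^{\dagger}$, is the (at most one) $S\in L(X)$ with $T=TST$, $S=STS$, and $TS$ and $ST$ hermitian. *)

theory Defs
  imports "HOL-Analysis.Analysis" "HOL-Algebra.Algebra" "HOL-Algebra.Algebraic_Closure_Type"
begin

text \<open>
  Normed spaces over the complex numbers are modules with an explicit carrier, so that subspaces,
  quotients and spaces of operators, which depend on sets rather than types, are again objects of
  the same kind.  As for modules in the library, the record inherits a multiplication and a unit;
  these matter only for algebras of operators and are arbitrary otherwise.
\<close>

record 'a cnormed = "(complex, 'a) module" +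
  vnorm :: "'a \<Rightarrow> real" (\<open>\<parallel>_\<parallel>\<index>\<close>)

abbreviation complex_ring :: "complex ring" where
  "complex_ring \<equiv> ring_of_type_algebra"

locale complex_normed_space = module complex_ring E
  for E :: "'a cnormed" (structure) +
  assumes vnorm_nonneg: "x \<in> carrier E \<Longrightarrow> 0 \<le> \<parallel>x\<parallel>"
    and vnorm_eq_zero_iff: "x \<in> carrier E \<Longrightarrow> \<parallel>x\<parallel> = 0 \<longleftrightarrow> x = \<zero>"
    and vnorm_smult: "x \<in> carrier E \<Longrightarrow> \<parallel>c \<odot> x\<parallel> = cmod c * \<parallel>x\<parallel>"
    and vnorm_triangle: "\<lbrakk>x \<in> carrier E; y \<in> carrier E\<rbrakk> \<Longrightarrow> \<parallel>x \<oplus> y\<parallel> \<le> \<parallel>x\<parallel> + \<parallel>y\<parallel>"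

text \<open>The library's metric spaces want nonnegativity and symmetry outside the carrier as well.\<close>

definition vdist :: "'a cnormed \<Rightarrow> 'a \<Rightarrow> 'a \<Rightarrow> real" where
  "vdist E x y = (if x \<in> carrier E \<and> y \<in> carrier E then \<parallel>x \<ominus>\<^bsub>E\<^esub> y\<parallel>\<^bsub>E\<^esub> else 0)"

abbreviation norm_topology :: "'a cnormed \<Rightarrow> 'a topology" where
  "norm_topology E \<equiv> Metric_space.mtopology (carrier E) (vdist E)"

locale complex_banach_space = complex_normed_space +
  assumes complete: "Metric_space.mcomplete (carrier E) (vdist E)"

definition closed_subspace :: "'a set \<Rightarrow> 'a cnormed \<Rightarrow> bool" where
  "closed_subspace Y E \<longleftrightarrow> submodule Y complex_ring E \<and> closedin (norm_topology E) Y"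

text \<open>
  Operators on \<open>E\<close> are extensional functions on \<open>carrier E\<close>, so that equality of operators is
  equality on \<open>E\<close>.
\<close>

definition bounded_operators :: "'a cnormed \<Rightarrow> ('a \<Rightarrow> 'a) set" where
  "bounded_operators E = {T \<in> carrier E \<rightarrow>\<^sub>E carrier E.
     (\<forall>x\<in>carrier E. \<forall>y\<in>carrier E. T (x \<oplus>\<^bsub>E\<^esub> y) = T x \<oplus>\<^bsub>E\<^esub> T y) \<and>
     (\<forall>c. \<forall>x\<in>carrier E. T (c \<odot>\<^bsub>E\<^esub> x) = c \<odot>\<^bsub>E\<^esub> T x) \<and>
     (\<exists>K. \<forall>x\<in>carrier E. \<parallel>T x\<parallel>\<^bsub>E\<^esub> \<le> K * \<parallel>x\<parallel>\<^bsub>E\<^esub>)}"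

definition operator_algebra :: "'a cnormed \<Rightarrow> ('a \<Rightarrow> 'a) cnormed" where
  "operator_algebra E =
    \<lparr>carrier = bounded_operators E,
     monoid.mult = compose (carrier E),
     one = (\<lambda>x\<in>carrier E. x),
     ring.zero = (\<lambda>x\<in>carrier E. \<zero>\<^bsub>E\<^esub>),
     add = (\<lambda>S T. \<lambda>x\<in>carrier E. S x \<oplus>\<^bsub>E\<^esub> T x),
     smult = (\<lambda>c T. \<lambda>x\<in>carrier E. c \<odot>\<^bsub>E\<^esub> T x),
     vnorm = (\<lambda>T. SUP x\<in>{x \<in> carrier E. \<parallel>x\<parallel>\<^bsub>E\<^esub> \<le> 1}. \<parallel>T x\<parallel>\<^bsub>E\<^esub>)\<rparr>"

text \<open>The following three notions are meant for a unital Banach algebra \<open>A\<close>.\<close>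

definition algebra_exp :: "'a cnormed \<Rightarrow> 'a \<Rightarrow> 'a" where
  "algebra_exp A a = (THE e. limitin (norm_topology A)
     (\<lambda>N. \<Oplus>\<^bsub>A\<^esub>n\<in>{..<N}. (1 / fact n) \<odot>\<^bsub>A\<^esub> (a [^]\<^bsub>A\<^esub> (n::nat))) e sequentially)"

definition hermitian :: "'a cnormed \<Rightarrow> 'a \<Rightarrow> bool" where
  "hermitian A h \<longleftrightarrow> h \<in> carrier A \<and>
     (\<forall>t::real. \<parallel>algebra_exp A ((\<i> * complex_of_real t) \<odot>\<^bsub>A\<^esub> h)\<parallel>\<^bsub>A\<^esub> = 1)"

text \<open>
  A relation rather than a function: for given \<open>a\<close> there is at most one such \<open>b\<close>.  In the operator
  algebra of the zero space the identity has norm 0, so no element is hermitian there and nothing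
  has a Moore-Penrose inverse.
\<close>

definition is_moore_penrose_inverse :: "'a cnormed \<Rightarrow> 'a \<Rightarrow> 'a \<Rightarrow> bool" where
  "is_moore_penrose_inverse A a b \<longleftrightarrow> a \<in> carrier A \<and> b \<in> carrier A \<and>
     a = a \<otimes>\<^bsub>A\<^esub> b \<otimes>\<^bsub>A\<^esub> a \<and> b = b \<otimes>\<^bsub>A\<^esub> a \<otimes>\<^bsub>A\<^esub> b \<and>
     hermitian A (a \<otimes>\<^bsub>A\<^esub> b) \<and> hermitian A (b \<otimes>\<^bsub>A\<^esub> a)"

definition subspace_of :: "'a cnormed \<Rightarrow> 'a set \<Rightarrow> 'a cnormed" where
  "subspace_of E Y = E\<lparr>carrier := Y\<rparr>"

definition quotient_space :: "'a cnormed \<Rightarrow> 'a set \<Rightarrow> 'a set cnormed" where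
  "quotient_space E Y =
    \<lparr>carrier = a_rcosets\<^bsub>E\<^esub> Y,
     monoid.mult = undefined,
     one = undefined,
     ring.zero = Y,
     add = set_add E,
     smult = (\<lambda>c C. \<Union>x\<in>C. Y +>\<^bsub>E\<^esub> (c \<odot>\<^bsub>E\<^esub> x)),
     vnorm = (\<lambda>C. INF x\<in>C. \<parallel>x\<parallel>\<^bsub>E\<^esub>)\<rparr>"

text \<open>
  If \<open>T\<close> leaves \<open>Y\<close> invariant, then all cosets in the union below are equal, and the induced
  operator maps the coset of \<open>x\<close> to the coset of \<open>T x\<close>; likewise for the scalar multiples above.
\<close>

definition quotient_operator :: "'a cnormed \<Rightarrow> 'a set \<Rightarrow> ('a \<Rightarrow> 'a) \<Rightarrow> 'a set \<Rightarrow> 'a set" where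
  "quotient_operator E Y T = (\<lambda>C\<in>carrier (quotient_space E Y). \<Union>x\<in>C. Y +>\<^bsub>E\<^esub> T x)"

definition direct_sum :: "'a cnormed \<Rightarrow> 'b cnormed \<Rightarrow> ('a \<times> 'b) cnormed" where
  "direct_sum E1 E2 =
    \<lparr>carrier = carrier E1 \<times> carrier E2,
     monoid.mult = undefined,
     one = undefined,
     ring.zero = (\<zero>\<^bsub>E1\<^esub>, \<zero>\<^bsub>E2\<^esub>),
     add = (\<lambda>(x1, x2) (y1, y2). (x1 \<oplus>\<^bsub>E1\<^esub> y1, x2 \<oplus>\<^bsub>E2\<^esub> y2)),
     smult = (\<lambda>c (x1, x2). (c \<odot>\<^bsub>E1\<^esub> x1, c \<odot>\<^bsub>E2\<^esub> x2)),
     vnorm = (\<lambda>(x1, x2). max \<parallel>x1\<parallel>\<^bsub>E1\<^esub> \<parallel>x2\<parallel>\<^bsub>E2\<^esub>)\<rparr>"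

definition direct_sum_operator ::
    "'a cnormed \<Rightarrow> 'b cnormed \<Rightarrow> ('a \<Rightarrow> 'a) \<Rightarrow> ('b \<Rightarrow> 'b) \<Rightarrow> 'a \<times> 'b \<Rightarrow> 'a \<times> 'b" where
  "direct_sum_operator E1 E2 T1 T2 =
     restrict (map_prod T1 T2) (carrier (direct_sum E1 E2))"

end

theory Submission
  imports Defs
begin

text \<open>
  The products \<open>T T\<^sup>\<dagger>\<close> and \<open>T\<^sup>\<dagger> T\<close> are idempotent, and for an idempotent \<open>P\<close> the exponential
  series collapses to \<open>exp (itP) = 1 + (e\<^sup>i\<^sup>t - 1) P\<close>.  These operators form a one-parameter group, so
  they all have norm 1 if and only if the space is nonzero and all of them are contractions.
  Hence being a Moore-Penrose inverse is a pointwise condition on vectors, which passes to invariant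
  subspaces and to maxima of norms, and to quotients because the quotient norm is an infimum over
  representatives.
\<close>

section \<open>Complex normed spaces\<close>

text \<open>The identities \<open>S T S = S\<close> and \<open>T S T = T\<close> give
  \<open>(S T)(S T) = S T\<close>, so the idempotence that makes the exponential summable in closed
  form comes from the algebraic half of the notion. The obstacle is the other half: being hermitian
  is stated through an operator norm, a supremum over one particular space. Passing to a subspace or
  a quotient by itself only shows that the norms there are at most 1. The lower bound is regained on
  the new space: the inverse of \<open>exp (itP)\<close> is \<open>exp (-itP)\<close>, again a
  contraction, so every \<open>exp (itP)\<close> is isometric, and a single nonzero vector then
  forces norm 1. This is why all real t are kept together and why each construction needs its own
  argument that the resulting space is nonzero.\<close>

lemma complex_ring_simps [simp]:
  "carrier complex_ring = UNIV" "\<one>\<^bsub>complex_ring\<^esub> = 1" "\<zero>\<^bsub>complex_ring\<^esub> = 0"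
  "x \<oplus>\<^bsub>complex_ring\<^esub> y = x + y" "x \<otimes>\<^bsub>complex_ring\<^esub> y = x * y"
  by (simp_all add: ring_of_type_algebra_def)

text \<open>Additive inverses are supplied by scalar multiplication with -1, and the norm of zero by
  homogeneity with scalar 0. Later instances refer to the premises by position: 13 is definiteness,
  14 homogeneity, 15 the triangle inequality.\<close>

lemma complex_normed_spaceI:
  fixes E :: "'a cnormed" (structure)
  assumes "\<And>x y. \<lbrakk>x \<in> carrier E; y \<in> carrier E\<rbrakk> \<Longrightarrow> x \<oplus> y \<in> carrier E"
    and "\<zero> \<in> carrier E"
    and "\<And>x y z. \<lbrakk>x \<in> carrier E; y \<in> carrier E; z \<in> carrier E\<rbrakk> \<Longrightarrow> (x \<oplus> y) \<oplus> z = x \<oplus> (y \<oplus> z)"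
    and "\<And>x y. \<lbrakk>x \<in> carrier E; y \<in> carrier E\<rbrakk> \<Longrightarrow> x \<oplus> y = y \<oplus> x"
    and "\<And>x. x \<in> carrier E \<Longrightarrow> \<zero> \<oplus> x = x"
    and "\<And>x. x \<in> carrier E \<Longrightarrow> (-1) \<odot> x \<oplus> x = \<zero>"
    and "\<And>c x. x \<in> carrier E \<Longrightarrow> c \<odot> x \<in> carrier E"
    and "\<And>a b x. x \<in> carrier E \<Longrightarrow> (a + b) \<odot> x = a \<odot> x \<oplus> b \<odot> x"
    and "\<And>c x y. \<lbrakk>x \<in> carrier E; y \<in> carrier E\<rbrakk> \<Longrightarrow> c \<odot> (x \<oplus> y) = c \<odot> x \<oplus> c \<odot> y"
    and "\<And>a b x. x \<in> carrier E \<Longrightarrow> (a * b) \<odot> x = a \<odot> (b \<odot> x)"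
    and "\<And>x. x \<in> carrier E \<Longrightarrow> 1 \<odot> x = x"
    and "\<And>x. x \<in> carrier E \<Longrightarrow> 0 \<le> \<parallel>x\<parallel>"
    and "\<And>x. \<lbrakk>x \<in> carrier E; \<parallel>x\<parallel> = 0\<rbrakk> \<Longrightarrow> x = \<zero>"
    and smult: "\<And>c x. x \<in> carrier E \<Longrightarrow> \<parallel>c \<odot> x\<parallel> = cmod c * \<parallel>x\<parallel>"
    and "\<And>x y. \<lbrakk>x \<in> carrier E; y \<in> carrier E\<rbrakk> \<Longrightarrow> \<parallel>x \<oplus> y\<parallel> \<le> \<parallel>x\<parallel> + \<parallel>y\<parallel>"
  shows "complex_normed_space E"
proof -
  have "abelian_group E"
  proof (rule abelian_groupI)
    show "\<exists>y\<in>carrier E. y \<oplus> x = \<zero>" if "x \<in> carrier E" for x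
      using that assms(6,7) by blast
  qed (fact assms(1-5))+
  then interpret module complex_ring E
    by (intro moduleI cring_from_type_algebra) (simp_all add: assms(7-11))
  have "\<parallel>\<zero>\<parallel> = 0"
    using smult[of "\<zero>" 0] smult_l_null[of "\<zero>"] by simp
  then show ?thesis
    by unfold_locales (auto simp: assms(12-))
qed

context complex_normed_space
begin

lemma smult_in_carrier [simp]: "x \<in> carrier E \<Longrightarrow> c \<odot> x \<in> carrier E"
  using smult_closed by simp

lemma smult_add_left: "x \<in> carrier E \<Longrightarrow> (a + b) \<odot> x = a \<odot> x \<oplus> b \<odot> x"
  using smult_l_distr[of a b x] by simp

lemma smult_add_right:
  "\<lbrakk>x \<in> carrier E; y \<in> carrier E\<rbrakk> \<Longrightarrow> c \<odot> (x \<oplus> y) = c \<odot> x \<oplus> c \<odot> y"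
  using smult_r_distr[of c x y] by simp

lemma smult_smult: "x \<in> carrier E \<Longrightarrow> a \<odot> (b \<odot> x) = (a * b) \<odot> x"
  using smult_assoc1[of a b x] by simp

lemma one_smult [simp]: "x \<in> carrier E \<Longrightarrow> 1 \<odot> x = x"
  using smult_one[of x] by simp

lemma zero_smult [simp]: "x \<in> carrier E \<Longrightarrow> 0 \<odot> x = \<zero>"
  using smult_l_null[of x] by simp

lemma smult_zero [simp]: "c \<odot> \<zero> = \<zero>"
  using smult_r_null[of c] by simp

lemma a_inv_eq_smult: "x \<in> carrier E \<Longrightarrow> \<ominus> x = (-1) \<odot> x"
  using smult_add_left[of x "-1" 1] by (intro minus_equality) auto

lemma minus_smult: "y \<in> carrier E \<Longrightarrow> x \<ominus> y = x \<oplus> (-1) \<odot> y"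
  by (simp add: a_minus_def a_inv_eq_smult)

lemma vnorm_zero [simp]: "\<parallel>\<zero>\<parallel> = 0"
  by (simp add: vnorm_eq_zero_iff)

lemma Metric_space_vdist: "Metric_space (carrier E) (vdist E)"
proof
  fix x y z
  show "0 \<le> vdist E x y"
    by (simp add: vdist_def vnorm_nonneg minus_smult)
  show "vdist E x y = vdist E y x"
  proof (cases "x \<in> carrier E \<and> y \<in> carrier E")
    case True
    then have "y \<ominus> x = (-1) \<odot> (x \<ominus> y)"
      by (simp add: minus_smult smult_add_right smult_smult a_comm)
    with True show ?thesis
      by (simp add: vdist_def vnorm_smult minus_closed)
  qed (auto simp: vdist_def)
  assume x: "x \<in> carrier E" and y: "y \<in> carrier E"
  have "x = y" if "x \<ominus> y = \<zero>"
  proof -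
    have "x = (x \<ominus> y) \<oplus> y"
      using x y by (simp add: a_minus_def a_assoc l_neg)
    with that y show ?thesis
      by simp
  qed
  with x y show "vdist E x y = 0 \<longleftrightarrow> x = y"
    by (auto simp: vdist_def vnorm_eq_zero_iff minus_closed a_minus_def r_neg)
  assume z: "z \<in> carrier E"
  have "x \<ominus> z = (x \<ominus> y) \<oplus> (y \<ominus> z)"
    using x y z by (simp add: a_minus_def a_assoc r_neg1)
  with x y z show "vdist E x z \<le> vdist E x y + vdist E y z"
    by (simp add: vdist_def vnorm_triangle minus_closed)
qed

end

section \<open>The algebra of bounded operators\<close>

lemma operator_algebra_simps [simp]:
  "carrier (operator_algebra E) = bounded_operators E"
  "S \<otimes>\<^bsub>operator_algebra E\<^esub> T = compose (carrier E) S T"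
  "\<one>\<^bsub>operator_algebra E\<^esub> = (\<lambda>x\<in>carrier E. x)"
  "\<zero>\<^bsub>operator_algebra E\<^esub> = (\<lambda>x\<in>carrier E. \<zero>\<^bsub>E\<^esub>)"
  "S \<oplus>\<^bsub>operator_algebra E\<^esub> T = (\<lambda>x\<in>carrier E. S x \<oplus>\<^bsub>E\<^esub> T x)"
  "c \<odot>\<^bsub>operator_algebra E\<^esub> T = (\<lambda>x\<in>carrier E. c \<odot>\<^bsub>E\<^esub> T x)"
  by (simp_all add: operator_algebra_def)

context complex_normed_space
begin

lemma bounded_operatorsI:
  assumes "\<And>x. x \<in> carrier E \<Longrightarrow> T x \<in> carrier E"
    and "\<And>x. x \<notin> carrier E \<Longrightarrow> T x = undefined"
    and "\<And>x y. \<lbrakk>x \<in> carrier E; y \<in> carrier E\<rbrakk> \<Longrightarrow> T (x \<oplus> y) = T x \<oplus> T y"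
    and "\<And>c x. x \<in> carrier E \<Longrightarrow> T (c \<odot> x) = c \<odot> T x"
    and "\<And>x. x \<in> carrier E \<Longrightarrow> \<parallel>T x\<parallel> \<le> K * \<parallel>x\<parallel>"
  shows "T \<in> bounded_operators E"
  unfolding bounded_operators_def
proof (intro CollectI conjI exI[of _ K])
  show "T \<in> carrier E \<rightarrow>\<^sub>E carrier E"
    using assms(1,2) by blast
qed (use assms(3-5) in auto)

lemma bounded_operatorsE:
  assumes "T \<in> bounded_operators E"
  obtains K where "0 \<le> K" "\<And>x. x \<in> carrier E \<Longrightarrow> \<parallel>T x\<parallel> \<le> K * \<parallel>x\<parallel>"
proof -
  obtain K where K: "\<And>x. x \<in> carrier E \<Longrightarrow> \<parallel>T x\<parallel> \<le> K * \<parallel>x\<parallel>"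
    using assms unfolding bounded_operators_def by blast
  \<comment> \<open>The definition does not fix the sign of the bound, which can be negative on the
    zero space. Truncating at 0 makes it safe to multiply inequalities by it.\<close>
  have "\<parallel>T x\<parallel> \<le> max K 0 * \<parallel>x\<parallel>" if "x \<in> carrier E" for x
    using K[OF that] mult_right_mono[of K "max K 0" "\<parallel>x\<parallel>"] vnorm_nonneg[OF that] by linarith
  with that show thesis
    by (meson max.cobounded2)
qed

lemma bounded_operators_closed:
  "\<lbrakk>T \<in> bounded_operators E; x \<in> carrier E\<rbrakk> \<Longrightarrow> T x \<in> carrier E"
  by (auto simp: bounded_operators_def)

lemma bounded_operators_undefined:
  "\<lbrakk>T \<in> bounded_operators E; x \<notin> carrier E\<rbrakk> \<Longrightarrow> T x = undefined"
  by (auto simp: bounded_operators_def)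

lemma bounded_operators_add:
  "\<lbrakk>T \<in> bounded_operators E; x \<in> carrier E; y \<in> carrier E\<rbrakk> \<Longrightarrow> T (x \<oplus> y) = T x \<oplus> T y"
  by (auto simp: bounded_operators_def)

lemma bounded_operators_smult:
  "\<lbrakk>T \<in> bounded_operators E; x \<in> carrier E\<rbrakk> \<Longrightarrow> T (c \<odot> x) = c \<odot> T x"
  by (auto simp: bounded_operators_def)

lemma bounded_operators_zero: "T \<in> bounded_operators E \<Longrightarrow> T \<zero> = \<zero>"
  using bounded_operators_smult[of T "\<zero>" 0] by (simp add: bounded_operators_closed)

lemmas bounded_operators_simps = bounded_operators_closed bounded_operators_undefined
  bounded_operators_add bounded_operators_smult bounded_operators_zero

lemma operator_ext:
  assumes "S \<in> bounded_operators E" "T \<in> bounded_operators E"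
    and "\<And>x. x \<in> carrier E \<Longrightarrow> S x = T x"
  shows "S = T"
proof
  fix x show "S x = T x"
    using assms by (cases "x \<in> carrier E") (auto simp: bounded_operators_undefined)
qed

lemma identity_operator: "(\<lambda>x\<in>carrier E. x) \<in> bounded_operators E"
  by (rule bounded_operatorsI[where K = 1]) auto

lemma zero_operator: "(\<lambda>x\<in>carrier E. \<zero>) \<in> bounded_operators E"
  by (rule bounded_operatorsI[where K = 0]) auto

lemma compose_operator:
  assumes S: "S \<in> bounded_operators E" and T: "T \<in> bounded_operators E"
  shows "compose (carrier E) S T \<in> bounded_operators E"
proof -
  obtain K where K: "0 \<le> K" "\<And>x. x \<in> carrier E \<Longrightarrow> \<parallel>S x\<parallel> \<le> K * \<parallel>x\<parallel>"
    using bounded_operatorsE[OF S] by blast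
  obtain L where L: "0 \<le> L" "\<And>x. x \<in> carrier E \<Longrightarrow> \<parallel>T x\<parallel> \<le> L * \<parallel>x\<parallel>"
    using bounded_operatorsE[OF T] by blast
  have "\<parallel>S (T x)\<parallel> \<le> (K * L) * \<parallel>x\<parallel>" if "x \<in> carrier E" for x
    using K(2)[of "T x"] mult_left_mono[OF L(2)[OF that] K(1)] that T
    by (simp add: bounded_operators_simps mult.assoc)
  with S T show ?thesis
    by (intro bounded_operatorsI[where K = "K * L"])
      (auto simp: compose_def bounded_operators_simps)
qed

lemma add_operator:
  assumes S: "S \<in> bounded_operators E" and T: "T \<in> bounded_operators E"
  shows "(\<lambda>x\<in>carrier E. S x \<oplus> T x) \<in> bounded_operators E"
proof -
  obtain K where K: "\<And>x. x \<in> carrier E \<Longrightarrow> \<parallel>S x\<parallel> \<le> K * \<parallel>x\<parallel>"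
    using bounded_operatorsE[OF S] by blast
  obtain L where L: "\<And>x. x \<in> carrier E \<Longrightarrow> \<parallel>T x\<parallel> \<le> L * \<parallel>x\<parallel>"
    using bounded_operatorsE[OF T] by blast
  have "\<parallel>S x \<oplus> T x\<parallel> \<le> (K + L) * \<parallel>x\<parallel>" if "x \<in> carrier E" for x
    using K[OF that] L[OF that] vnorm_triangle[of "S x" "T x"] that S T
    by (simp add: bounded_operators_simps distrib_right)
  with S T show ?thesis
    by (intro bounded_operatorsI[where K = "K + L"])
      (auto simp: bounded_operators_simps smult_add_right a_ac)
qed

lemma smult_operator:
  assumes T: "T \<in> bounded_operators E"
  shows "(\<lambda>x\<in>carrier E. c \<odot> T x) \<in> bounded_operators E"
proof -
  obtain K where K: "\<And>x. x \<in> carrier E \<Longrightarrow> \<parallel>T x\<parallel> \<le> K * \<parallel>x\<parallel>"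
    using bounded_operatorsE[OF T] by blast
  have "\<parallel>c \<odot> T x\<parallel> \<le> (cmod c * K) * \<parallel>x\<parallel>" if "x \<in> carrier E" for x
    using mult_left_mono[OF K[OF that], of "cmod c"] that T
    by (simp add: bounded_operators_simps vnorm_smult mult.assoc)
  with T show ?thesis
    by (intro bounded_operatorsI[where K = "cmod c * K"])
      (auto simp: bounded_operators_simps smult_add_right smult_smult mult.commute)
qed

lemmas operator_closed =
  identity_operator zero_operator compose_operator add_operator smult_operator

section \<open>The operator norm as a supremum over the unit ball\<close>

lemma operator_norm_le:
  assumes T: "T \<in> bounded_operators E" and "x \<in> carrier E" "\<parallel>x\<parallel> \<le> 1"
  shows "\<parallel>T x\<parallel> \<le> \<parallel>T\<parallel>\<^bsub>operator_algebra E\<^esub>"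
proof -
  obtain K where K: "0 \<le> K" "\<And>x. x \<in> carrier E \<Longrightarrow> \<parallel>T x\<parallel> \<le> K * \<parallel>x\<parallel>"
    using bounded_operatorsE[OF T] by blast
  have "\<parallel>T y\<parallel> \<le> K" if "y \<in> carrier E" "\<parallel>y\<parallel> \<le> 1" for y
    using K(2)[OF that(1)] mult_left_mono[OF that(2) K(1)] by simp
  \<comment> \<open>A real supremum is an upper bound only for sets that are bounded above;
    boundedness of \<open>T\<close> guarantees this.\<close>
  then have "bdd_above ((\<lambda>y. \<parallel>T y\<parallel>) ` {y \<in> carrier E. \<parallel>y\<parallel> \<le> 1})"
    by (auto intro!: bdd_aboveI)
  with assms show ?thesis
    by (auto simp: operator_algebra_def intro!: cSUP_upper)
qed

lemma operator_norm_bound: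
  assumes T: "T \<in> bounded_operators E" and x: "x \<in> carrier E"
  shows "\<parallel>T x\<parallel> \<le> \<parallel>T\<parallel>\<^bsub>operator_algebra E\<^esub> * \<parallel>x\<parallel>"
proof (cases "x = \<zero>")
  case True
  with T show ?thesis
    by (simp add: bounded_operators_simps)
next
  case False
  with x have pos: "0 < \<parallel>x\<parallel>"
    using vnorm_nonneg vnorm_eq_zero_iff by (simp add: less_le)
  \<comment> \<open>Scales \<open>x\<close> to norm 1, so that it lies in the unit ball.\<close>
  let ?c = "complex_of_real (1 / \<parallel>x\<parallel>)"
  have "\<parallel>T (?c \<odot> x)\<parallel> \<le> \<parallel>T\<parallel>\<^bsub>operator_algebra E\<^esub>"
    using x pos by (intro operator_norm_le T) (auto simp: vnorm_smult norm_divide)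
  then have "(1 / \<parallel>x\<parallel>) * \<parallel>T x\<parallel> \<le> \<parallel>T\<parallel>\<^bsub>operator_algebra E\<^esub>"
    using x T pos by (simp add: bounded_operators_simps vnorm_smult norm_divide)
  with pos show ?thesis
    by (simp add: field_simps)
qed

lemma operator_norm_least:
  assumes "\<And>x. \<lbrakk>x \<in> carrier E; \<parallel>x\<parallel> \<le> 1\<rbrakk> \<Longrightarrow> \<parallel>T x\<parallel> \<le> K"
  shows "\<parallel>T\<parallel>\<^bsub>operator_algebra E\<^esub> \<le> K"
proof -
  \<comment> \<open>The zero vector keeps the supremum from being taken over an empty set, even on
    the zero space.\<close>
  have "\<zero> \<in> {x \<in> carrier E. \<parallel>x\<parallel> \<le> 1}"
    by simp
  with assms show ?thesis
    unfolding operator_algebra_def by (auto intro!: cSUP_least)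
qed

lemma operator_norm_nonneg:
  assumes "T \<in> bounded_operators E"
  shows "0 \<le> \<parallel>T\<parallel>\<^bsub>operator_algebra E\<^esub>"
  using operator_norm_le[OF assms, of "\<zero>"] assms by (simp add: bounded_operators_simps)

lemma operator_norm_smult_le:
  assumes T: "T \<in> bounded_operators E"
  shows "\<parallel>\<lambda>x\<in>carrier E. c \<odot> T x\<parallel>\<^bsub>operator_algebra E\<^esub> \<le> cmod c * \<parallel>T\<parallel>\<^bsub>operator_algebra E\<^esub>"
  using T by (intro operator_norm_least)
    (simp add: bounded_operators_simps vnorm_smult operator_norm_le mult_left_mono)

text \<open>Needed to speak of finite sums and limits of operators, from which
  \<open>algebra_exp\<close> is built.\<close>

lemma complex_normed_space_operator_algebra: "complex_normed_space (operator_algebra E)"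
proof (rule complex_normed_spaceI, goal_cases)
  case (13 T)
  show ?case
  proof (rule operator_ext)
    fix x assume x: "x \<in> carrier E"
    with 13 have "\<parallel>T x\<parallel> \<le> 0"
      using operator_norm_bound[of T x] by simp
    with x 13 show "T x = \<zero>\<^bsub>operator_algebra E\<^esub> x"
      using vnorm_nonneg[of "T x"] vnorm_eq_zero_iff[of "T x"]
      by (simp add: bounded_operators_simps)
  qed (use 13 in \<open>simp_all add: zero_operator\<close>)
next
  case (14 c T)
  let ?S = "\<lambda>x\<in>carrier E. c \<odot> T x"
  have T: "T \<in> bounded_operators E"
    using 14 by simp
  have "cmod c * \<parallel>T\<parallel>\<^bsub>operator_algebra E\<^esub> \<le> \<parallel>?S\<parallel>\<^bsub>operator_algebra E\<^esub>"
  proof (cases "c = 0")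
    case True
    with operator_norm_nonneg[OF smult_operator[OF T]] show ?thesis
      by simp
  next
    case False
    \<comment> \<open>The reverse inequality of homogeneity is the easy inequality applied to
      \<open>inverse c\<close> and the operator \<open>?S\<close>.\<close>
    then have "T = (\<lambda>x\<in>carrier E. inverse c \<odot> ?S x)"
      using T by (intro operator_ext smult_operator)
        (simp_all add: bounded_operators_simps smult_smult)
    then have "\<parallel>T\<parallel>\<^bsub>operator_algebra E\<^esub> \<le> cmod (inverse c) * \<parallel>?S\<parallel>\<^bsub>operator_algebra E\<^esub>"
      using operator_norm_smult_le[OF smult_operator[OF T], of "inverse c" c] by simp
    with False show ?thesis
      by (simp add: norm_divide field_simps)
  qed
  with operator_norm_smult_le[OF T] show ?case
    by (simp add: antisym)
next
  case (15 S T)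
  then have "\<parallel>S x \<oplus> T x\<parallel> \<le> \<parallel>S\<parallel>\<^bsub>operator_algebra E\<^esub> + \<parallel>T\<parallel>\<^bsub>operator_algebra E\<^esub>"
    if "x \<in> carrier E" "\<parallel>x\<parallel> \<le> 1" for x
    using that vnorm_triangle[of "S x" "T x"] operator_norm_le[of S x] operator_norm_le[of T x]
    by (simp add: bounded_operators_simps)
  then show ?case
    by (auto intro: operator_norm_least)
qed (auto simp: operator_closed operator_norm_nonneg bounded_operators_simps a_ac smult_smult
    smult_add_left smult_add_right l_neg r_neg simp flip: a_inv_eq_smult intro!: ext)

lemma monoid_operator_algebra: "monoid (operator_algebra E)"
  by (rule monoidI) (auto simp: operator_closed compose_eq bounded_operators_simps
      intro!: operator_ext)

section \<open>Hermitian idempotents\<close>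

text \<open>Every power of \<open>c P\<close> from the first on is a scalar multiple of
  \<open>P\<close>. A partial sum is therefore the unit plus a scalar multiple of \<open>P\<close>,
  and convergence reduces to that of the scalar exponential series.\<close>

lemma limitin_algebra_exp_idempotent:
  fixes c :: complex
  defines "A \<equiv> operator_algebra E"
  assumes P: "P \<in> bounded_operators E" and idem: "\<And>x. x \<in> carrier E \<Longrightarrow> P (P x) = P x"
  shows "limitin (norm_topology A)
    (\<lambda>N. \<Oplus>\<^bsub>A\<^esub>n\<in>{..<N}. (1 / fact n) \<odot>\<^bsub>A\<^esub> ((c \<odot>\<^bsub>A\<^esub> P) [^]\<^bsub>A\<^esub> (n::nat)))
    (\<one>\<^bsub>A\<^esub> \<oplus>\<^bsub>A\<^esub> (exp c - 1) \<odot>\<^bsub>A\<^esub> P) sequentially"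
proof -
  interpret A: complex_normed_space A
    unfolding A_def by (rule complex_normed_space_operator_algebra)
  interpret A: monoid A
    unfolding A_def by (rule monoid_operator_algebra)
  have P_in [simp]: "P \<in> carrier A"
    using P by (simp add: A_def)
  have PP: "(a \<odot>\<^bsub>A\<^esub> P) \<otimes>\<^bsub>A\<^esub> (b \<odot>\<^bsub>A\<^esub> P) = (a * b) \<odot>\<^bsub>A\<^esub> P" for a b
    using P idem unfolding A_def
    by (auto simp: operator_closed compose_eq bounded_operators_simps smult_smult
        intro!: operator_ext)
  \<comment> \<open>Stated from exponent 1 on, because the zeroth power is the unit and not
    \<open>P\<close>. The same exception causes the \<open>- 1\<close> in the coefficient of the
    limit.\<close>
  have pow: "(c \<odot>\<^bsub>A\<^esub> P) [^]\<^bsub>A\<^esub> Suc n = c ^ Suc n \<odot>\<^bsub>A\<^esub> P" for n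
  proof (induction n)
    case (Suc n)
    then show ?case
      by (subst A.nat_pow_Suc) (simp add: PP mult.commute)
  qed simp
  define s where "s N = (\<Oplus>\<^bsub>A\<^esub>n\<in>{..<N}. (1 / fact n) \<odot>\<^bsub>A\<^esub> ((c \<odot>\<^bsub>A\<^esub> P) [^]\<^bsub>A\<^esub> n))" for N :: nat
  define e where "e N = (\<Sum>n<N. c ^ n / fact n)" for N :: nat
  \<comment> \<open>The formula fails for the empty sum, which lacks the unit; hence the shift by
    one, undone at the end by \<open>filterlim_sequentially_Suc\<close>.\<close>
  have s: "s (Suc N) = \<one>\<^bsub>A\<^esub> \<oplus>\<^bsub>A\<^esub> (e (Suc N) - 1) \<odot>\<^bsub>A\<^esub> P" for N
  proof (induction N)
    case (Suc N)
    have "s (Suc (Suc N)) = (c ^ Suc N / fact (Suc N)) \<odot>\<^bsub>A\<^esub> P \<oplus>\<^bsub>A\<^esub> s (Suc N)"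
      unfolding s_def by (subst lessThan_Suc, subst A.finsum_insert)
        (simp_all only: pow, auto simp: A.smult_smult)
    also have "\<dots> = \<one>\<^bsub>A\<^esub> \<oplus>\<^bsub>A\<^esub>
        ((c ^ Suc N / fact (Suc N)) \<odot>\<^bsub>A\<^esub> P \<oplus>\<^bsub>A\<^esub> (e (Suc N) - 1) \<odot>\<^bsub>A\<^esub> P)"
      unfolding Suc by (simp add: A.a_ac)
    also have "\<dots> = \<one>\<^bsub>A\<^esub> \<oplus>\<^bsub>A\<^esub> (e (Suc (Suc N)) - 1) \<odot>\<^bsub>A\<^esub> P"
      by (subst A.smult_add_left[symmetric]) (auto simp: e_def algebra_simps)
    finally show ?case .
  qed (simp add: s_def e_def lessThan_Suc)
  have dist: "vdist A (s (Suc N)) (\<one>\<^bsub>A\<^esub> \<oplus>\<^bsub>A\<^esub> (exp c - 1) \<odot>\<^bsub>A\<^esub> P)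
      = cmod (e (Suc N) - exp c) * \<parallel>P\<parallel>\<^bsub>A\<^esub>" for N
  proof -
    have "s (Suc N) \<ominus>\<^bsub>A\<^esub> (\<one>\<^bsub>A\<^esub> \<oplus>\<^bsub>A\<^esub> (exp c - 1) \<odot>\<^bsub>A\<^esub> P)
        = (\<one>\<^bsub>A\<^esub> \<oplus>\<^bsub>A\<^esub> \<ominus>\<^bsub>A\<^esub> \<one>\<^bsub>A\<^esub>) \<oplus>\<^bsub>A\<^esub>
          ((e (Suc N) - 1) \<odot>\<^bsub>A\<^esub> P \<oplus>\<^bsub>A\<^esub> (1 - exp c) \<odot>\<^bsub>A\<^esub> P)"
      by (simp add: s A.minus_smult A.smult_add_right A.smult_smult A.a_inv_eq_smult A.a_ac)
    also have "\<dots> = (e (Suc N) - exp c) \<odot>\<^bsub>A\<^esub> P"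
      by (simp add: A.r_neg flip: A.smult_add_left)
    finally show ?thesis
      by (simp add: vdist_def s A.vnorm_smult)
  qed
  have "(\<lambda>N. e N) \<longlonglongrightarrow> exp c"
    using exp_converges[of c] unfolding sums_def e_def by (simp add: scaleR_conv_of_real field_simps)
  then have "(\<lambda>N. cmod (e (Suc N) - exp c) * \<parallel>P\<parallel>\<^bsub>A\<^esub>) \<longlonglongrightarrow> 0"
    by (intro tendsto_mult_left_zero tendsto_norm_zero)
      (simp add: LIM_zero_iff LIMSEQ_Suc)
  then have "(\<lambda>N. vdist A (s N) (\<one>\<^bsub>A\<^esub> \<oplus>\<^bsub>A\<^esub> (exp c - 1) \<odot>\<^bsub>A\<^esub> P)) \<longlonglongrightarrow> 0"
    by (subst filterlim_sequentially_Suc[symmetric]) (simp add: dist)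
  moreover have "s N \<in> carrier A" for N
    unfolding s_def by (rule A.finsum_closed) auto
  ultimately show ?thesis
    unfolding s_def[symmetric]
    by (auto simp: Metric_space.limitin_metric_dist_null[OF A.Metric_space_vdist])
qed

text \<open>The definite description in \<open>algebra_exp\<close> is resolved by the uniqueness of
  limits in a metric space.\<close>

lemma algebra_exp_idempotent:
  assumes "P \<in> bounded_operators E" and "\<And>x. x \<in> carrier E \<Longrightarrow> P (P x) = P x"
  shows "algebra_exp (operator_algebra E) (c \<odot>\<^bsub>operator_algebra E\<^esub> P)
    = (\<lambda>x\<in>carrier E. x \<oplus> (exp c - 1) \<odot> P x)"
proof -
  interpret A: complex_normed_space "operator_algebra E"
    by (rule complex_normed_space_operator_algebra)
  have "algebra_exp (operator_algebra E) (c \<odot>\<^bsub>operator_algebra E\<^esub> P)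
    = \<one>\<^bsub>operator_algebra E\<^esub> \<oplus>\<^bsub>operator_algebra E\<^esub> (exp c - 1) \<odot>\<^bsub>operator_algebra E\<^esub> P"
    unfolding algebra_exp_def
  proof (rule the_equality)
    fix e
    assume "limitin (norm_topology (operator_algebra E))
      (\<lambda>N. \<Oplus>\<^bsub>operator_algebra E\<^esub>n\<in>{..<N}. (1 / fact n) \<odot>\<^bsub>operator_algebra E\<^esub>
        ((c \<odot>\<^bsub>operator_algebra E\<^esub> P) [^]\<^bsub>operator_algebra E\<^esub> (n::nat))) e sequentially"
    from Metric_space.limitin_metric_unique[OF A.Metric_space_vdist this
        limitin_algebra_exp_idempotent[OF assms]]
    show "e = \<one>\<^bsub>operator_algebra E\<^esub> \<oplus>\<^bsub>operator_algebra E\<^esub>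
        (exp c - 1) \<odot>\<^bsub>operator_algebra E\<^esub> P"
      by simp
  qed (rule limitin_algebra_exp_idempotent[OF assms])
  also have "\<dots> = (\<lambda>x\<in>carrier E. x \<oplus> (exp c - 1) \<odot> P x)"
    by auto
  finally show ?thesis .
qed

text \<open>The right-hand side contains neither a limit nor a supremum. From left to right, the
  operator norm bounds each vector; conversely, contractions whose inverses are contractions are
  isometries, and a nonzero vector attains the norm 1.\<close>

lemma hermitian_idempotent_iff:
  assumes P: "P \<in> bounded_operators E" and idem: "\<And>x. x \<in> carrier E \<Longrightarrow> P (P x) = P x"
  shows "hermitian (operator_algebra E) P \<longleftrightarrow> carrier E \<noteq> {\<zero>} \<and>
    (\<forall>t::real. \<forall>x\<in>carrier E. \<parallel>x \<oplus> (exp (\<i> * t) - 1) \<odot> P x\<parallel> \<le> \<parallel>x\<parallel>)"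
proof -
  define U where "U t = (\<lambda>x\<in>carrier E. x \<oplus> (exp (\<i> * complex_of_real t) - 1) \<odot> P x)" for t
  have U_in: "U t \<in> bounded_operators E" for t
    using add_operator[OF identity_operator smult_operator[OF P]]
    by (simp add: U_def cong: restrict_cong)
  have U_inverse: "U (- t) (U t x) = x" if x: "x \<in> carrier E" for t x
  proof -
    define a where "a = exp (\<i> * complex_of_real t)"
    define b where "b = exp (\<i> * complex_of_real (- t))"
    have ab: "b * a = 1"
      by (simp add: a_def b_def flip: exp_add)
    have "P x \<in> carrier E"
      using x P by (simp add: bounded_operators_simps)
    then have "U (- t) (U t x)
        = x \<oplus> ((a - 1) \<odot> P x \<oplus> ((b - 1) \<odot> P x \<oplus> ((b - 1) * (a - 1)) \<odot> P x))"
      using x P unfolding U_def a_def[symmetric] b_def[symmetric]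
      by (simp add: bounded_operators_simps idem smult_add_right smult_smult a_assoc)
    also have "\<dots> = x \<oplus> ((a - 1) + ((b - 1) + (b - 1) * (a - 1))) \<odot> P x"
      using \<open>P x \<in> carrier E\<close> by (simp only: smult_add_left)
    \<comment> \<open>The coefficient expands to \<open>b * a - 1\<close>: the operators multiply as
      their scalars do.\<close>
    also have "(a - 1) + ((b - 1) + (b - 1) * (a - 1)) = 0"
      using ab by (simp add: algebra_simps)
    finally show ?thesis
      using x \<open>P x \<in> carrier E\<close> by simp
  qed
  have "hermitian (operator_algebra E) P \<longleftrightarrow> (\<forall>t. \<parallel>U t\<parallel>\<^bsub>operator_algebra E\<^esub> = 1)"
    using P unfolding hermitian_def U_def by (simp only: algebra_exp_idempotent[OF P idem])
      (simp add: exp_of_real)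
  also have "\<dots> \<longleftrightarrow> carrier E \<noteq> {\<zero>} \<and> (\<forall>t. \<forall>x\<in>carrier E. \<parallel>U t x\<parallel> \<le> \<parallel>x\<parallel>)"
  proof (intro iffI conjI notI allI ballI; (elim conjE)?)
    assume norm: "\<forall>t. \<parallel>U t\<parallel>\<^bsub>operator_algebra E\<^esub> = 1" and "carrier E = {\<zero>}"
    then have "\<parallel>U 0\<parallel>\<^bsub>operator_algebra E\<^esub> \<le> 0"
      by (intro operator_norm_least) (simp add: bounded_operators_zero[OF U_in])
    with norm show False
      by simp
  next
    fix t x assume "\<forall>t. \<parallel>U t\<parallel>\<^bsub>operator_algebra E\<^esub> = 1" and "x \<in> carrier E"
    then show "\<parallel>U t x\<parallel> \<le> \<parallel>x\<parallel>"
      using operator_norm_bound[OF U_in, of x t] by simp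
  next
    fix t assume "carrier E \<noteq> {\<zero>}" and contr: "\<forall>t. \<forall>x\<in>carrier E. \<parallel>U t x\<parallel> \<le> \<parallel>x\<parallel>"
    then obtain x where x: "x \<in> carrier E" "x \<noteq> \<zero>"
      using zero_closed by blast
    have "\<parallel>U t\<parallel>\<^bsub>operator_algebra E\<^esub> \<le> 1"
      using contr by (intro operator_norm_least) (meson order_trans)
    \<comment> \<open>The contraction at parameter \<open>- t\<close> is applied to the vector
      \<open>U t x\<close> and brings it back to \<open>x\<close>.\<close>
    moreover have "\<parallel>x\<parallel> \<le> \<parallel>U t x\<parallel>"
      using contr x U_inverse[of x t] bounded_operators_closed[OF U_in] by metis
    then have "\<parallel>x\<parallel> \<le> \<parallel>U t\<parallel>\<^bsub>operator_algebra E\<^esub> * \<parallel>x\<parallel>"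
      using operator_norm_bound[OF U_in x(1), of t] by linarith
    then have "1 \<le> \<parallel>U t\<parallel>\<^bsub>operator_algebra E\<^esub>"
      using x vnorm_nonneg[of x] vnorm_eq_zero_iff[of x] by (simp add: less_le)
    ultimately show "\<parallel>U t\<parallel>\<^bsub>operator_algebra E\<^esub> = 1"
      by simp
  qed
  finally show ?thesis
    by (simp add: U_def)
qed

text \<open>The working form for all three constructions. The criterion for hermitian elements
  applies only to idempotents, hence the case distinction: if the algebraic identities hold, both
  products are idempotent; if they fail, both sides are false.\<close>

lemma is_moore_penrose_inverse_iff:
  "is_moore_penrose_inverse (operator_algebra E) S T \<longleftrightarrow>
    carrier E \<noteq> {\<zero>} \<and> S \<in> bounded_operators E \<and> T \<in> bounded_operators E \<and>
    (\<forall>x\<in>carrier E. S (T (S x)) = S x \<and> T (S (T x)) = T x \<and>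
      (\<forall>t::real. \<parallel>x \<oplus> (exp (\<i> * t) - 1) \<odot> S (T x)\<parallel> \<le> \<parallel>x\<parallel> \<and>
        \<parallel>x \<oplus> (exp (\<i> * t) - 1) \<odot> T (S x)\<parallel> \<le> \<parallel>x\<parallel>))"
proof (cases "S \<in> bounded_operators E \<and> T \<in> bounded_operators E \<and>
    (\<forall>x\<in>carrier E. S (T (S x)) = S x \<and> T (S (T x)) = T x)")
  case True
  then have "compose (carrier E) (compose (carrier E) S T) S = S"
    and "compose (carrier E) (compose (carrier E) T S) T = T"
    by (auto simp: operator_closed compose_eq bounded_operators_simps intro!: operator_ext)
  moreover have "hermitian (operator_algebra E) (compose (carrier E) S T) \<longleftrightarrow> carrier E \<noteq> {\<zero>} \<and>
      (\<forall>t::real. \<forall>x\<in>carrier E. \<parallel>x \<oplus> (exp (\<i> * t) - 1) \<odot> compose (carrier E) S T x\<parallel> \<le> \<parallel>x\<parallel>)"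
    using True by (intro hermitian_idempotent_iff)
      (auto simp: operator_closed compose_eq bounded_operators_simps)
  moreover have "hermitian (operator_algebra E) (compose (carrier E) T S) \<longleftrightarrow> carrier E \<noteq> {\<zero>} \<and>
      (\<forall>t::real. \<forall>x\<in>carrier E. \<parallel>x \<oplus> (exp (\<i> * t) - 1) \<odot> compose (carrier E) T S x\<parallel> \<le> \<parallel>x\<parallel>)"
    using True by (intro hermitian_idempotent_iff)
      (auto simp: operator_closed compose_eq bounded_operators_simps)
  ultimately show ?thesis
    using True unfolding is_moore_penrose_inverse_def by (simp add: compose_eq) blast
next
  case False
  have "S (T (S x)) = S x \<and> T (S (T x)) = T x"
    if "is_moore_penrose_inverse (operator_algebra E) S T" "x \<in> carrier E" for x
  proof -
    have "compose (carrier E) (compose (carrier E) S T) S x = S x"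
      and "compose (carrier E) (compose (carrier E) T S) T x = T x"
      and "S x \<in> carrier E" "T x \<in> carrier E"
      using that by (simp_all add: is_moore_penrose_inverse_def bounded_operators_simps)
    with that show ?thesis
      by (simp add: compose_eq)
  qed
  with False show ?thesis
    by (auto simp: is_moore_penrose_inverse_def)
qed

end

section \<open>Subspaces\<close>

context complex_normed_space
begin

lemma complex_normed_space_subspace:
  assumes "submodule Y complex_ring E"
  shows "complex_normed_space (subspace_of E Y)"
proof -
  have sub: "Y \<subseteq> carrier E"
    using assms by (rule submoduleE)
  interpret Y: module complex_ring "E\<lparr>carrier := Y\<rparr>"
    using submodule.submodule_is_module[OF assms module_axioms] .
  show ?thesis
    unfolding subspace_of_def
    by unfold_locales
      (use sub in \<open>auto simp: vnorm_nonneg vnorm_eq_zero_iff vnorm_smult vnorm_triangle subset_iff\<close>)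
qed

lemma restrict_operator:
  assumes "submodule Y complex_ring E" "T \<in> bounded_operators E" "T ` Y \<subseteq> Y"
  shows "restrict T Y \<in> bounded_operators (subspace_of E Y)"
proof -
  interpret Y: complex_normed_space "subspace_of E Y"
    by (rule complex_normed_space_subspace) fact
  have sub: "x \<in> carrier E" if "x \<in> Y" for x
    using that submoduleE(1)[OF assms(1)] by blast
  obtain K where "\<And>x. x \<in> carrier E \<Longrightarrow> \<parallel>T x\<parallel> \<le> K * \<parallel>x\<parallel>"
    using bounded_operatorsE[OF assms(2)] by blast
  with assms sub submoduleE(4,5)[OF assms(1)] show ?thesis
    by (intro Y.bounded_operatorsI[where K = K])
      (auto simp: subspace_of_def bounded_operators_simps)
qed

text \<open>Operations and norm on \<open>Y\<close> are those of \<open>E\<close>, so the pointwise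
  conditions are merely quantified over fewer vectors. Only the nonvanishing of the space has to be
  supplied afresh.\<close>

lemma is_moore_penrose_inverse_subspace:
  assumes mp: "is_moore_penrose_inverse (operator_algebra E) S T"
    and Y: "submodule Y complex_ring E" "Y \<noteq> {\<zero>}" "S ` Y \<subseteq> Y" "T ` Y \<subseteq> Y"
  shows "is_moore_penrose_inverse (operator_algebra (subspace_of E Y)) (restrict S Y) (restrict T Y)"
proof -
  interpret Y: complex_normed_space "subspace_of E Y"
    by (rule complex_normed_space_subspace) fact
  have closed: "S x \<in> Y" "T x \<in> Y" "x \<in> carrier E" if "x \<in> Y" for x
    using that Y submoduleE(1)[OF Y(1)] by blast+
  have "S \<in> bounded_operators E" "T \<in> bounded_operators E"
    using mp by (simp_all add: is_moore_penrose_inverse_iff)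
  then have "restrict S Y \<in> bounded_operators (subspace_of E Y)"
    and "restrict T Y \<in> bounded_operators (subspace_of E Y)"
    using Y by (simp_all add: restrict_operator)
  then show ?thesis
    using mp closed Y(2)
    unfolding is_moore_penrose_inverse_iff Y.is_moore_penrose_inverse_iff
    by (simp add: subspace_of_def)
qed

end

section \<open>Quotients\<close>

locale normed_quotient = complex_normed_space +
  fixes Y
  assumes Y: "closed_subspace Y E"
begin

abbreviation "Q \<equiv> quotient_space E Y"

lemma submodule_Y: "submodule Y complex_ring E"
  using Y by (simp add: closed_subspace_def)

sublocale abelian_subgroup Y E
  by (intro abelian_subgroupI3 additive_subgroupI M.abelian_group_axioms
      submodule.axioms(1)[OF submodule_Y])

lemma Y_smult: "h \<in> Y \<Longrightarrow> c \<odot> h \<in> Y"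
  using submoduleE(4)[OF submodule_Y] by simp

lemma Y_in_carrier [simp]: "h \<in> Y \<Longrightarrow> h \<in> carrier E"
  using a_subset by blast

lemma coset_eq: "\<lbrakk>x' \<in> Y +> x; x \<in> carrier E\<rbrakk> \<Longrightarrow> Y +> x' = Y +> x"
  using a_repr_independence' by blast

lemma in_cosetE:
  assumes "x' \<in> Y +> x"
  obtains h where "h \<in> Y" "x' = h \<oplus> x"
  using assms by (auto simp: a_r_coset_def')

lemma coset_in_carrier: "\<lbrakk>x' \<in> Y +> x; x \<in> carrier E\<rbrakk> \<Longrightarrow> x' \<in> carrier E"
  by (auto elim!: in_cosetE)

lemma carrier_quotient: "carrier Q = (\<lambda>x. Y +> x) ` carrier E"
  by (auto simp: quotient_space_def A_RCOSETS_def')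

lemma coset_in_quotient [simp]: "x \<in> carrier E \<Longrightarrow> Y +> x \<in> carrier Q"
  by (simp add: carrier_quotient)

lemma quotient_cases:
  assumes "C \<in> carrier Q"
  obtains x where "x \<in> carrier E" "C = Y +> x"
  using assms by (auto simp: carrier_quotient)

lemma quotient_zero: "\<zero>\<^bsub>Q\<^esub> = Y +> \<zero>"
  using a_subset by (simp add: quotient_space_def)

lemma quotient_add:
  "\<lbrakk>x \<in> carrier E; y \<in> carrier E\<rbrakk> \<Longrightarrow> (Y +> x) \<oplus>\<^bsub>Q\<^esub> (Y +> y) = Y +> (x \<oplus> y)"
  by (simp add: quotient_space_def a_rcos_sum)

text \<open>Well-definedness on cosets: if \<open>f\<close> maps the coset of \<open>x\<close> into
  the coset of \<open>f x\<close>, the union runs over equal cosets. It serves both scalar multiples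
  and induced operators, which are defined as such unions.\<close>

lemma Union_cosets:
  assumes x: "x \<in> carrier E" and f: "f x \<in> carrier E"
    and "\<And>h. h \<in> Y \<Longrightarrow> \<exists>k\<in>Y. f (h \<oplus> x) = k \<oplus> f x"
  shows "(\<Union>x'\<in>Y +> x. Y +> f x') = Y +> f x"
proof -
  have "Y +> f x' = Y +> f x" if x': "x' \<in> Y +> x" for x'
    using in_cosetE[OF x'] assms(3) f by (metis a_rcosI a_subset coset_eq)
  with a_rcos_self[OF x] show ?thesis
    by (intro UN_constant_eq) blast+
qed

lemma quotient_smult:
  assumes "x \<in> carrier E"
  shows "c \<odot>\<^bsub>Q\<^esub> (Y +> x) = Y +> (c \<odot> x)"
  unfolding quotient_space_def
  using assms by (simp, intro Union_cosets) (auto simp: smult_add_right Y_smult)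

section \<open>The quotient norm\<close>

lemma quotient_norm: "\<parallel>C\<parallel>\<^bsub>Q\<^esub> = (INF x\<in>C. \<parallel>x\<parallel>)"
  by (simp add: quotient_space_def)

lemma quotient_norm_le:
  assumes "x \<in> carrier E"
  shows "\<parallel>Y +> x\<parallel>\<^bsub>Q\<^esub> \<le> \<parallel>x\<parallel>"
  unfolding quotient_norm
proof (rule cINF_lower)
  show "bdd_below (vnorm E ` (Y +> x))"
    by (rule bdd_belowI[of _ 0]) (use assms coset_in_carrier vnorm_nonneg in blast)
qed (use assms a_rcos_self in blast)

lemma quotient_norm_greatest:
  assumes x: "x \<in> carrier E"
    and "\<And>x'. \<lbrakk>x' \<in> carrier E; Y +> x' = Y +> x\<rbrakk> \<Longrightarrow> r \<le> \<parallel>x'\<parallel>"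
  shows "r \<le> \<parallel>Y +> x\<parallel>\<^bsub>Q\<^esub>"
  unfolding quotient_norm
proof (rule cINF_greatest)
  show "Y +> x \<noteq> {}"
    using a_rcos_self[OF x] by blast
  fix x' assume "x' \<in> Y +> x"
  from coset_in_carrier[OF this x] coset_eq[OF this x] show "r \<le> \<parallel>x'\<parallel>"
    by (rule assms(2))
qed

text \<open>The infimum need not be attained, so arguments choose representatives that are only
  nearly optimal.\<close>

lemma quotient_norm_less:
  assumes x: "x \<in> carrier E" and "\<parallel>Y +> x\<parallel>\<^bsub>Q\<^esub> < r"
  obtains x' where "x' \<in> carrier E" "Y +> x' = Y +> x" "\<parallel>x'\<parallel> < r"
  using quotient_norm_greatest[OF x, of r] assms(2) by force

text \<open>This is where closedness of \<open>Y\<close> enters. If \<open>x\<close> is outside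
  \<open>Y\<close>, some ball of radius \<open>r\<close> around \<open>x\<close> misses
  \<open>Y\<close>; but a representative \<open>x'\<close> of norm below \<open>r\<close> yields the
  element \<open>x \<ominus> x'\<close> of \<open>Y\<close> at distance less than \<open>r\<close>
  from \<open>x\<close>.\<close>

lemma coset_trivial:
  assumes x: "x \<in> carrier E" and "\<parallel>Y +> x\<parallel>\<^bsub>Q\<^esub> = 0"
  shows "x \<in> Y"
proof (rule ccontr)
  assume "x \<notin> Y"
  interpret M: Metric_space "carrier E" "vdist E"
    by (rule Metric_space_vdist)
  obtain r where r: "0 < r" "disjnt Y (M.mball x r)"
    using Y \<open>x \<notin> Y\<close> x by (auto simp: closed_subspace_def M.closedin_metric)
  obtain x' where x': "x' \<in> carrier E" "Y +> x' = Y +> x" "\<parallel>x'\<parallel> < r"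
    using quotient_norm_less[OF x, of r] assms(2) r(1) by auto
  obtain h where h: "h \<in> Y" "x = h \<oplus> x'"
    using x' a_rcos_self[OF x] by (auto elim: in_cosetE)
  have "x \<ominus> h = x'"
    using h x' by (simp add: a_minus_def a_comm[of h x'] a_assoc r_neg)
  then have "h \<in> M.mball x r"
    using x x' h by (auto simp: vdist_def)
  with r h show False
    by (auto simp: disjnt_iff)
qed

lemma coset_eq_zero_iff: "x \<in> carrier E \<Longrightarrow> Y +> x = Y \<longleftrightarrow> x \<in> Y"
  using a_rcos_self a_coset_join2[OF _ a_subgroup] by blast

lemma quotient_norm_smult_le:
  assumes "x \<in> carrier E"
  shows "\<parallel>Y +> (c \<odot> x)\<parallel>\<^bsub>Q\<^esub> \<le> cmod c * \<parallel>Y +> x\<parallel>\<^bsub>Q\<^esub>"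
proof (cases "c = 0")
  case True
  with assms quotient_norm_le[of "\<zero>"] show ?thesis
    by simp
next
  case False
  \<comment> \<open>Dividing by \<open>cmod c\<close> leaves the plain norm of a representative on
    the right, so that the infimum can be taken.\<close>
  have "\<parallel>Y +> (c \<odot> x)\<parallel>\<^bsub>Q\<^esub> / cmod c \<le> \<parallel>Y +> x\<parallel>\<^bsub>Q\<^esub>"
  proof (rule quotient_norm_greatest)
    fix x' assume x': "x' \<in> carrier E" "Y +> x' = Y +> x"
    then have "Y +> (c \<odot> x) = Y +> (c \<odot> x')"
      using assms by (simp flip: quotient_smult)
    with x' quotient_norm_le[of "c \<odot> x'"] False
    show "\<parallel>Y +> (c \<odot> x)\<parallel>\<^bsub>Q\<^esub> / cmod c \<le> \<parallel>x'\<parallel>"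
      by (simp add: vnorm_smult field_simps)
  qed fact
  with False show ?thesis
    by (simp add: field_simps)
qed

lemma quotient_norm_triangle:
  assumes "x \<in> carrier E" "y \<in> carrier E"
  shows "\<parallel>Y +> (x \<oplus> y)\<parallel>\<^bsub>Q\<^esub> \<le> \<parallel>Y +> x\<parallel>\<^bsub>Q\<^esub> + \<parallel>Y +> y\<parallel>\<^bsub>Q\<^esub>"
proof (rule field_le_epsilon)
  fix e :: real assume "0 < e"
  then obtain x' y'
    where x': "x' \<in> carrier E" "Y +> x' = Y +> x" "\<parallel>x'\<parallel> < \<parallel>Y +> x\<parallel>\<^bsub>Q\<^esub> + e / 2"
      and y': "y' \<in> carrier E" "Y +> y' = Y +> y" "\<parallel>y'\<parallel> < \<parallel>Y +> y\<parallel>\<^bsub>Q\<^esub> + e / 2"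
    using quotient_norm_less[OF assms(1), of "\<parallel>Y +> x\<parallel>\<^bsub>Q\<^esub> + e / 2"]
      quotient_norm_less[OF assms(2), of "\<parallel>Y +> y\<parallel>\<^bsub>Q\<^esub> + e / 2"]
    by (metis half_gt_zero less_add_same_cancel1)
  have "Y +> (x \<oplus> y) = Y +> (x' \<oplus> y')"
    using assms x' y' by (simp flip: quotient_add)
  then have "\<parallel>Y +> (x \<oplus> y)\<parallel>\<^bsub>Q\<^esub> \<le> \<parallel>x' \<oplus> y'\<parallel>"
    using x' y' quotient_norm_le[of "x' \<oplus> y'"] by simp
  with vnorm_triangle[OF x'(1) y'(1)] x'(3) y'(3)
  show "\<parallel>Y +> (x \<oplus> y)\<parallel>\<^bsub>Q\<^esub> \<le> \<parallel>Y +> x\<parallel>\<^bsub>Q\<^esub> + \<parallel>Y +> y\<parallel>\<^bsub>Q\<^esub> + e"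
    by simp
qed

lemma complex_normed_space_quotient: "complex_normed_space Q"
proof (rule complex_normed_spaceI, goal_cases)
  case (13 C)
  then obtain x where x: "x \<in> carrier E" "C = Y +> x"
    by (blast elim: quotient_cases)
  with 13 have "C = Y"
    using coset_trivial coset_eq_zero_iff by simp
  then show ?case
    by (simp add: quotient_space_def)
next
  case (14 c C)
  then obtain x where x: "x \<in> carrier E" "C = Y +> x"
    by (rule quotient_cases)
  have "cmod c * \<parallel>Y +> x\<parallel>\<^bsub>Q\<^esub> \<le> \<parallel>Y +> (c \<odot> x)\<parallel>\<^bsub>Q\<^esub>"
  proof (cases "c = 0")
    case True
    have "0 \<le> \<parallel>Y +> (c \<odot> x)\<parallel>\<^bsub>Q\<^esub>"
      using x by (intro quotient_norm_greatest vnorm_nonneg) auto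
    with True show ?thesis
      by simp
  next
    case False
    with x have "Y +> x = Y +> (inverse c \<odot> (c \<odot> x))"
      by (simp add: smult_smult)
    with quotient_norm_smult_le[of "c \<odot> x" "inverse c"] x
    have "\<parallel>Y +> x\<parallel>\<^bsub>Q\<^esub> \<le> cmod (inverse c) * \<parallel>Y +> (c \<odot> x)\<parallel>\<^bsub>Q\<^esub>"
      by simp
    with False show ?thesis
      by (simp add: norm_divide field_simps)
  qed
  with quotient_norm_smult_le x show ?case
    by (simp add: quotient_smult antisym)
qed (auto elim!: quotient_cases simp: quotient_add quotient_smult quotient_zero smult_add_left
    smult_add_right smult_smult a_ac l_neg r_neg quotient_norm_triangle
    intro: quotient_norm_greatest vnorm_nonneg
    simp flip: a_inv_eq_smult simp del: a_coset_add_zero)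

section \<open>Operators induced on the quotient\<close>

lemma quotient_operator_coset:
  assumes "T \<in> bounded_operators E" "T ` Y \<subseteq> Y" "x \<in> carrier E"
  shows "quotient_operator E Y T (Y +> x) = Y +> T x"
  using assms by (simp add: quotient_operator_def, intro Union_cosets)
    (auto simp: bounded_operators_simps)

lemma quotient_operator_bounded:
  assumes T: "T \<in> bounded_operators E" "T ` Y \<subseteq> Y"
  shows "quotient_operator E Y T \<in> bounded_operators Q"
proof -
  interpret Q: complex_normed_space Q
    by (rule complex_normed_space_quotient)
  obtain K where K: "0 \<le> K" "\<And>x. x \<in> carrier E \<Longrightarrow> \<parallel>T x\<parallel> \<le> K * \<parallel>x\<parallel>"
    using bounded_operatorsE[OF T(1)] by blast
  \<comment> \<open>\<open>K\<close> may be 0; the constant \<open>K + 1\<close> is positive and can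
    be divided out before taking the infimum.\<close>
  have "\<parallel>Y +> T x\<parallel>\<^bsub>Q\<^esub> \<le> (K + 1) * \<parallel>Y +> x\<parallel>\<^bsub>Q\<^esub>" if x: "x \<in> carrier E" for x
  proof -
    have "\<parallel>Y +> T x\<parallel>\<^bsub>Q\<^esub> / (K + 1) \<le> \<parallel>Y +> x\<parallel>\<^bsub>Q\<^esub>"
    proof (rule quotient_norm_greatest)
      fix x' assume x': "x' \<in> carrier E" "Y +> x' = Y +> x"
      then have "Y +> T x = Y +> T x'"
        using T x by (simp flip: quotient_operator_coset)
      then have "\<parallel>Y +> T x\<parallel>\<^bsub>Q\<^esub> \<le> K * \<parallel>x'\<parallel>"
        using quotient_norm_le[of "T x'"] K(2)[OF x'(1)] T x' by (simp add: bounded_operators_simps)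
      also have "\<dots> \<le> (K + 1) * \<parallel>x'\<parallel>"
        using vnorm_nonneg[OF x'(1)] by (simp add: distrib_right)
      finally show "\<parallel>Y +> T x\<parallel>\<^bsub>Q\<^esub> / (K + 1) \<le> \<parallel>x'\<parallel>"
        using K(1) by (simp add: field_simps)
    qed fact
    with K(1) show ?thesis
      by (simp add: field_simps)
  qed
  moreover have "quotient_operator E Y T C = undefined" if "C \<notin> carrier Q" for C
    using that by (simp add: quotient_operator_def)
  ultimately show ?thesis
    using T by (intro Q.bounded_operatorsI[where K = "K + 1"])
      (auto elim!: quotient_cases
        simp: quotient_operator_coset quotient_add quotient_smult bounded_operators_simps)
qed

text \<open>Each representative \<open>x'\<close> of the coset of \<open>x\<close> gives a
  representative \<open>x' \<oplus> c \<odot> T x'\<close> of the target coset with norm at most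
  that of \<open>x'\<close>; the infimum over \<open>x'\<close> gives the claim. \<open>T\<close> is
  an arbitrary function compatible with cosets, so that a product of two operators can be inserted
  pointwise.\<close>

lemma quotient_contraction:
  assumes T: "\<And>x. x \<in> carrier E \<Longrightarrow> T x \<in> carrier E"
    and ind: "\<And>x x'. \<lbrakk>x \<in> carrier E; x' \<in> carrier E; Y +> x' = Y +> x\<rbrakk> \<Longrightarrow> Y +> T x' = Y +> T x"
    and contr: "\<And>x. x \<in> carrier E \<Longrightarrow> \<parallel>x \<oplus> c \<odot> T x\<parallel> \<le> \<parallel>x\<parallel>"
    and x: "x \<in> carrier E"
  shows "\<parallel>Y +> (x \<oplus> c \<odot> T x)\<parallel>\<^bsub>Q\<^esub> \<le> \<parallel>Y +> x\<parallel>\<^bsub>Q\<^esub>"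
proof (rule quotient_norm_greatest)
  fix x' assume x': "x' \<in> carrier E" "Y +> x' = Y +> x"
  have "Y +> (x \<oplus> c \<odot> T x) = Y +> (x' \<oplus> c \<odot> T x')"
    using x x' T ind[OF x x'] by (simp flip: quotient_add quotient_smult)
  with quotient_norm_le[of "x' \<oplus> c \<odot> T x'"] contr[OF x'(1)] T x'
  show "\<parallel>Y +> (x \<oplus> c \<odot> T x)\<parallel>\<^bsub>Q\<^esub> \<le> \<parallel>x'\<parallel>"
    by simp
qed fact

lemma is_moore_penrose_inverse_quotient:
  assumes mp: "is_moore_penrose_inverse (operator_algebra E) S T"
    and "Y \<noteq> carrier E" and S: "S ` Y \<subseteq> Y" and T: "T ` Y \<subseteq> Y"
  shows "is_moore_penrose_inverse (operator_algebra Q)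
    (quotient_operator E Y S) (quotient_operator E Y T)"
proof -
  interpret Q: complex_normed_space Q
    by (rule complex_normed_space_quotient)
  have S_in: "S \<in> bounded_operators E" and T_in: "T \<in> bounded_operators E"
    using mp by (simp_all add: is_moore_penrose_inverse_iff)
  note q = quotient_operator_coset[OF S_in S] quotient_operator_coset[OF T_in T]
  note closed = bounded_operators_closed[OF S_in] bounded_operators_closed[OF T_in]
  \<comment> \<open>Both factors descend to cosets, hence so do the products: read backwards,
    \<open>q\<close> turns each side into induced operators applied to one coset.\<close>
  have ind: "Y +> S (T x') = Y +> S (T x)" "Y +> T (S x') = Y +> T (S x)"
    if "x \<in> carrier E" "x' \<in> carrier E" "Y +> x' = Y +> x" for x x'
    using that closed by (simp_all flip: q)
  obtain x where "x \<in> carrier E" "x \<notin> Y"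
    using \<open>Y \<noteq> carrier E\<close> a_subset by blast
  then have "carrier Q \<noteq> {\<zero>\<^bsub>Q\<^esub>}"
    using coset_in_quotient[of x] coset_eq_zero_iff[of x] by (auto simp: quotient_space_def)
  moreover have "\<parallel>Y +> (x \<oplus> (exp (\<i> * complex_of_real t) - 1) \<odot> S (T x))\<parallel>\<^bsub>Q\<^esub> \<le> \<parallel>Y +> x\<parallel>\<^bsub>Q\<^esub>"
    if "x \<in> carrier E" for x t
    by (rule quotient_contraction[where T = "\<lambda>x. S (T x)", OF _ ind(1) _ that])
      (use mp closed in \<open>auto simp: is_moore_penrose_inverse_iff\<close>)
  moreover have "\<parallel>Y +> (x \<oplus> (exp (\<i> * complex_of_real t) - 1) \<odot> T (S x))\<parallel>\<^bsub>Q\<^esub> \<le> \<parallel>Y +> x\<parallel>\<^bsub>Q\<^esub>"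
    if "x \<in> carrier E" for x t
    by (rule quotient_contraction[where T = "\<lambda>x. T (S x)", OF _ ind(2) _ that])
      (use mp closed in \<open>auto simp: is_moore_penrose_inverse_iff\<close>)
  moreover have "S (T (S x)) = S x" "T (S (T x)) = T x" if "x \<in> carrier E" for x
    using mp that by (simp_all add: is_moore_penrose_inverse_iff)
  ultimately show ?thesis
    \<comment> \<open>With the carrier written as an image, quantification over cosets becomes
      quantification over vectors of \<open>E\<close>.\<close>
    unfolding Q.is_moore_penrose_inverse_iff carrier_quotient ball_simps
    using quotient_operator_bounded[OF S_in S] quotient_operator_bounded[OF T_in T]
    by (simp add: q closed quotient_add quotient_smult)
qed

end

section \<open>Direct sums\<close>

locale normed_direct_sum = E1: complex_normed_space E1 + E2: complex_normed_space E2
  for E1 :: "'b cnormed" and E2 :: "'c cnormed"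
begin

lemma direct_sum_simps:
  "carrier (direct_sum E1 E2) = carrier E1 \<times> carrier E2"
  "\<zero>\<^bsub>direct_sum E1 E2\<^esub> = (\<zero>\<^bsub>E1\<^esub>, \<zero>\<^bsub>E2\<^esub>)"
  "(x1, x2) \<oplus>\<^bsub>direct_sum E1 E2\<^esub> (y1, y2) = (x1 \<oplus>\<^bsub>E1\<^esub> y1, x2 \<oplus>\<^bsub>E2\<^esub> y2)"
  "c \<odot>\<^bsub>direct_sum E1 E2\<^esub> (x1, x2) = (c \<odot>\<^bsub>E1\<^esub> x1, c \<odot>\<^bsub>E2\<^esub> x2)"
  "\<parallel>(x1, x2)\<parallel>\<^bsub>direct_sum E1 E2\<^esub> = max \<parallel>x1\<parallel>\<^bsub>E1\<^esub> \<parallel>x2\<parallel>\<^bsub>E2\<^esub>"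
  by (simp_all add: direct_sum_def)

lemma complex_normed_space_direct_sum: "complex_normed_space (direct_sum E1 E2)"
proof (rule complex_normed_spaceI, goal_cases)
  case (13 x)
  then show ?case
    using E1.vnorm_nonneg[of "fst x"] E2.vnorm_nonneg[of "snd x"]
    by (auto simp: direct_sum_simps max_def E1.vnorm_eq_zero_iff E2.vnorm_eq_zero_iff
        split: if_splits)
next
  case (15 x y)
  then show ?case
    using E1.vnorm_triangle[of "fst x" "fst y"] E2.vnorm_triangle[of "snd x" "snd y"]
    by (auto simp: direct_sum_simps)
qed (auto simp: direct_sum_simps E1.a_ac E2.a_ac E1.smult_add_left E2.smult_add_left
    E1.smult_add_right E2.smult_add_right E1.smult_smult E2.smult_smult E1.r_neg E2.r_neg
    E1.l_neg E2.l_neg E1.vnorm_nonneg E2.vnorm_nonneg E1.vnorm_smult E2.vnorm_smult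
    max_mult_distrib_left le_max_iff_disj
    simp flip: E1.a_inv_eq_smult E2.a_inv_eq_smult)

lemma direct_sum_operator_apply:
  "\<lbrakk>x1 \<in> carrier E1; x2 \<in> carrier E2\<rbrakk> \<Longrightarrow>
    direct_sum_operator E1 E2 T1 T2 (x1, x2) = (T1 x1, T2 x2)"
  by (simp add: direct_sum_operator_def direct_sum_simps)

lemma direct_sum_operator_bounded:
  assumes T: "T1 \<in> bounded_operators E1" "T2 \<in> bounded_operators E2"
  shows "direct_sum_operator E1 E2 T1 T2 \<in> bounded_operators (direct_sum E1 E2)"
proof -
  interpret S: complex_normed_space "direct_sum E1 E2"
    by (rule complex_normed_space_direct_sum)
  obtain K1 where K1: "0 \<le> K1" "\<And>x. x \<in> carrier E1 \<Longrightarrow> \<parallel>T1 x\<parallel>\<^bsub>E1\<^esub> \<le> K1 * \<parallel>x\<parallel>\<^bsub>E1\<^esub>"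
    using E1.bounded_operatorsE[OF T(1)] by blast
  obtain K2 where K2: "0 \<le> K2" "\<And>x. x \<in> carrier E2 \<Longrightarrow> \<parallel>T2 x\<parallel>\<^bsub>E2\<^esub> \<le> K2 * \<parallel>x\<parallel>\<^bsub>E2\<^esub>"
    using E2.bounded_operatorsE[OF T(2)] by blast
  have "\<parallel>(T1 x1, T2 x2)\<parallel>\<^bsub>direct_sum E1 E2\<^esub> \<le> max K1 K2 * \<parallel>(x1, x2)\<parallel>\<^bsub>direct_sum E1 E2\<^esub>"
    if x: "x1 \<in> carrier E1" "x2 \<in> carrier E2" for x1 x2
  proof -
    let ?m = "max \<parallel>x1\<parallel>\<^bsub>E1\<^esub> \<parallel>x2\<parallel>\<^bsub>E2\<^esub>"
    have "K1 * \<parallel>x1\<parallel>\<^bsub>E1\<^esub> \<le> max K1 K2 * ?m" "K2 * \<parallel>x2\<parallel>\<^bsub>E2\<^esub> \<le> max K1 K2 * ?m"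
      using K1(1) K2(1) x by (intro mult_mono; auto simp: E1.vnorm_nonneg E2.vnorm_nonneg le_max_iff_disj)+
    with K1(2)[OF x(1)] K2(2)[OF x(2)] show ?thesis
      by (simp add: direct_sum_simps)
  qed
  with T show ?thesis
    by (intro S.bounded_operatorsI[where K = "max K1 K2"])
      (auto simp: direct_sum_simps direct_sum_operator_def
        E1.bounded_operators_simps E2.bounded_operators_simps)
qed

text \<open>The scalar \<open>exp (\<i> * t) - 1\<close> is the same in both coordinates, so the two
  contraction inequalities for one t combine by monotonicity of \<open>max\<close>. Deleting
  \<open>max.bounded_iff\<close> keeps the inequality between maxima whole for
  \<open>max.mono\<close>.\<close>

lemma is_moore_penrose_inverse_direct_sum:
  assumes "is_moore_penrose_inverse (operator_algebra E1) S1 T1"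
    and "is_moore_penrose_inverse (operator_algebra E2) S2 T2"
  shows "is_moore_penrose_inverse (operator_algebra (direct_sum E1 E2))
    (direct_sum_operator E1 E2 S1 S2) (direct_sum_operator E1 E2 T1 T2)"
proof -
  interpret S: complex_normed_space "direct_sum E1 E2"
    by (rule complex_normed_space_direct_sum)
  have "carrier E1 \<times> carrier E2 \<noteq> {(\<zero>\<^bsub>E1\<^esub>, \<zero>\<^bsub>E2\<^esub>)}"
    using assms E2.zero_closed by (auto simp: E1.is_moore_penrose_inverse_iff)
  moreover have "S1 \<in> bounded_operators E1" "T1 \<in> bounded_operators E1"
      "S2 \<in> bounded_operators E2" "T2 \<in> bounded_operators E2"
    using assms
    by (simp_all add: E1.is_moore_penrose_inverse_iff E2.is_moore_penrose_inverse_iff)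
  ultimately show ?thesis
    using assms
    unfolding E1.is_moore_penrose_inverse_iff E2.is_moore_penrose_inverse_iff
      S.is_moore_penrose_inverse_iff
    by (simp add: direct_sum_simps direct_sum_operator_apply direct_sum_operator_bounded
        E1.bounded_operators_closed E2.bounded_operators_closed max.mono del: max.bounded_iff)
qed

end

theorem proposition7:
  fixes E :: "'a cnormed" and T Td :: "'a \<Rightarrow> 'a" and Y :: "'a set"
    and E1 :: "'b cnormed" and T1 Td1 :: "'b \<Rightarrow> 'b"
    and E2 :: "'c cnormed" and T2 Td2 :: "'c \<Rightarrow> 'c"
  shows
    "(complex_banach_space E \<and> T \<in> carrier (operator_algebra E) \<and>
      is_moore_penrose_inverse (operator_algebra E) T Td \<and>
      closed_subspace Y E \<and> T ` Y \<subseteq> Y \<and> Td ` Y \<subseteq> Y \<longrightarrow>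
        (Y \<noteq> {\<zero>\<^bsub>E\<^esub>} \<longrightarrow>
          is_moore_penrose_inverse (operator_algebra (subspace_of E Y))
            (restrict T Y) (restrict Td Y)) \<and>
        (Y \<noteq> carrier E \<longrightarrow>
          is_moore_penrose_inverse (operator_algebra (quotient_space E Y))
            (quotient_operator E Y T) (quotient_operator E Y Td))) \<and>
     (complex_banach_space E1 \<and> complex_banach_space E2 \<and>
      T1 \<in> carrier (operator_algebra E1) \<and> T2 \<in> carrier (operator_algebra E2) \<and>
      is_moore_penrose_inverse (operator_algebra E1) T1 Td1 \<and>
      is_moore_penrose_inverse (operator_algebra E2) T2 Td2 \<longrightarrow>
        is_moore_penrose_inverse (operator_algebra (direct_sum E1 E2))
          (direct_sum_operator E1 E2 T1 T2) (direct_sum_operator E1 E2 Td1 Td2))"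
proof (intro conjI impI; elim conjE)
  assume E: "complex_banach_space E"
    and mp: "is_moore_penrose_inverse (operator_algebra E) T Td"
    and Y: "closed_subspace Y E" and inv: "T ` Y \<subseteq> Y" "Td ` Y \<subseteq> Y"
  interpret complex_normed_space E
    using E by (rule complex_banach_space.axioms)
  interpret normed_quotient E Y
    by unfold_locales (rule Y)
  show "is_moore_penrose_inverse (operator_algebra (subspace_of E Y)) (restrict T Y) (restrict Td Y)"
    if "Y \<noteq> {\<zero>\<^bsub>E\<^esub>}"
    using is_moore_penrose_inverse_subspace[OF mp submodule_Y that inv] .
  show "is_moore_penrose_inverse (operator_algebra (quotient_space E Y))
      (quotient_operator E Y T) (quotient_operator E Y Td)"
    if "Y \<noteq> carrier E"
    using is_moore_penrose_inverse_quotient[OF mp that inv] .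
next
  assume E: "complex_banach_space E1" "complex_banach_space E2"
    and mp: "is_moore_penrose_inverse (operator_algebra E1) T1 Td1"
      "is_moore_penrose_inverse (operator_algebra E2) T2 Td2"
  interpret normed_direct_sum E1 E2
    using E by (intro normed_direct_sum.intro complex_banach_space.axioms)
  show "is_moore_penrose_inverse (operator_algebra (direct_sum E1 E2))
      (direct_sum_operator E1 E2 T1 T2) (direct_sum_operator E1 E2 Td1 Td2)"
    using is_moore_penrose_inverse_direct_sum[OF mp] .
qed

end
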